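(* For all $1\le p\le\infty$ we have $$C_{0,p}=\left(\frac{p+1}{p-1}\right)^{1/p},\qquad C_{0,p,\infty}=2^{1/p},$$ with the usual limiting interpretations at the endpoints, i.e. $C_{0,1}=\infty$, $C_{0,\infty}=1$, $C_{0,1,\infty}=2$, $C_{0,\infty,\infty}=1$. The function $\chi_{\{0\}}$ is an extremizer for $C_{0,p,\infty}$, i.e. the inequality defining $C_{0,p,\infty}$ holds with equality for $S=\{0\}$. With $S_m:=\{1,2,\dots,m\}$, the sequence $(\chi_{S_m})_{m\in\mathbb{N}}$ is extremizing for $C_{0,p}$, i.e. $$C_{0,p}=\lim_{m\to\infty}\frac{\|\mathcal{M}\chi_{S_m}\|_{\ell^p(\mathbb{Z})}}{\|\chi_{S_m}\|_{\ell^p(\mathbb{Z})}}.$$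
   Context: An interval in $\mathbb{Z}$ is a nonempty finite set of consecutive integers; $|A|$ denotes the cardinality of $A\subseteq\mathbb{Z}$. For $f:\mathbb{Z}\to\mathbb{R}$ the discrete uncentered maximal function is $\mathcal{M}f(n)=\sup_{I\ni n}\frac1{|I|}\sum_{i\in I}|f(i)|$, the supremum being over all intervals $I\subset\mathbb{Z}$ containing $n$. For $S\subseteq\mathbb{Z}$, $\chi_S$ is its characteristic function. For $1\le p\le\infty$, $C_{0,p}\in[0,\infty]$ is the smallest number such that $\|\mathcal{M}\chi_S\|_{\ell^p(\mathbb{Z})}\le C_{0,p}\|\chi_S\|_{\ell^p(\mathbb{Z})}$ for all $S\subseteq\mathbb{Z}$ with $\|\chi_S\|_{\ell^p(\mathbb{Z})}<\infty$. For $1\le p<\infty$, $C_{0,p,\infty}\in[0,\infty]$ is the smallest number such that $$\sup_{\lambda>0}\bigl(\lambda\,|\{n\in\mathbb{Z}:\mathcal{M}\chi_S(n)>\lambda\}|\bigr)^{1/p}\le C_{0,p,\infty}\|\chi_S\|_{\ell^p(\mathbb{Z})}$$ for all $S\subseteq\mathbb{Z}$ with $\|\chi_S\|_{\ell^p(\mathbb{Z})}<\infty$. For $p=\infty$ the left-hand side is interpreted as $\|\mathcal{M}\chi_S\|_{\ell^\infty(\mathbb{Z})}$. *)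

theory Defs
  imports "HOL-Analysis.Analysis"
begin

text \<open>Real powers of extended nonnegative reals. Only exponents \<open>a > 0\<close> are relevant;
  for these \<open>\<infinity>\<close> to the power \<open>a\<close> is \<open>\<infinity>\<close>.\<close>

definition epowr :: "ennreal \<Rightarrow> real \<Rightarrow> ennreal" where
  "epowr x a = (if x = \<infinity> then \<infinity> else ennreal (enn2real x powr a))"

definition int_interval :: "int set \<Rightarrow> bool" where
  "int_interval I \<longleftrightarrow> (\<exists>a b. a \<le> b \<and> I = {a..b})"

definition maximal_fun :: "(int \<Rightarrow> real) \<Rightarrow> int \<Rightarrow> ennreal" where
  "maximal_fun f n =
     (SUP I \<in> {I. int_interval I \<and> n \<in> I}. ennreal ((\<Sum>i\<in>I. \<bar>f i\<bar>) / real (card I)))"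

text \<open>The \<open>\<ell>\<^sup>p\<close> norm for \<open>1 \<le> p \<le> \<infinity>\<close>, of functions with values in \<open>[0, \<infinity>]\<close>: both \<open>maximal_fun f\<close>
  and characteristic functions are nonnegative, so no absolute value is needed. The integral with
  respect to counting measure is the (possibly infinite) sum over the integers.\<close>

definition lp_norm :: "ennreal \<Rightarrow> (int \<Rightarrow> ennreal) \<Rightarrow> ennreal" where
  "lp_norm p g =
     (if p = \<infinity> then (SUP n. g n)
      else epowr (\<integral>\<^sup>+ n. epowr (g n) (enn2real p) \<partial>count_space UNIV) (1 / enn2real p))"

text \<open>The factor \<open>t\<close> stands inside the power \<open>1 / p\<close>, so for \<open>1 < p < \<infinity>\<close> this is not the usual
  weak \<open>L\<^sup>p\<close> quasinorm. Counting measure makes the cardinality of an infinite set \<open>\<infinity>\<close>.\<close>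

definition weak_norm :: "ennreal \<Rightarrow> (int \<Rightarrow> ennreal) \<Rightarrow> ennreal" where
  "weak_norm p g =
     (if p = \<infinity> then lp_norm \<infinity> g
      else (SUP t \<in> {0::real<..}.
              epowr (ennreal t * emeasure (count_space UNIV) {n. g n > ennreal t})
                (1 / enn2real p)))"

definition C0 :: "ennreal \<Rightarrow> ennreal" where
  "C0 p = (LEAST C. \<forall>S::int set. lp_norm p (indicator S) < \<infinity> \<longrightarrow>
      lp_norm p (maximal_fun (indicator S)) \<le> C * lp_norm p (indicator S))"

definition C0_weak :: "ennreal \<Rightarrow> ennreal" where
  "C0_weak p = (LEAST C. \<forall>S::int set. lp_norm p (indicator S) < \<infinity> \<longrightarrow>
      weak_norm p (maximal_fun (indicator S)) \<le> C * lp_norm p (indicator S))"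

end

(* The sharp estimate behind both constants is t |{M > t} - S| <= 2 (1 - t) |S| for the maximal
   function M of the characteristic function of a finite set S. To see it, choose for each of finitely
   many points of {M > t} - S an interval of density more than t, thin these intervals out so that
   no point is covered more than twice, and add up the inequalities sum over I of (chi_S - t) > 0.
   It gives t |{M > t}| <= 2 |S|, and it bounds the k-th largest value of M outside S by
   2 |S| / (2 |S| + k); summing p-th powers against an integral yields (p + 1) / (p - 1) |S|.
   Intervals S_m show that the latter is sharp, since M is m / (m + k) at distance k from S_m. *)

theory Submission
  imports Defs
begin

section \<open>Thinning out finite interval covers\<close>

text \<open>A subfamily with the same union and the fewest members works: if three of its intervals
  met in a point, the one reaching furthest left and the one reaching furthest right would cover a
  third, which could be dropped.\<close>

lemma finite_interval_subcover:
  fixes F :: "'a::linorder set set"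
  assumes "finite F" and int: "\<And>I. I \<in> F \<Longrightarrow> \<exists>a b. I = {a..b}"
  obtains G where "G \<subseteq> F" "\<Union>G = \<Union>F" "\<And>x. card {I \<in> G. x \<in> I} \<le> 2"
proof -
  define P where "P G \<longleftrightarrow> G \<subseteq> F \<and> \<Union>G = \<Union>F" for G
  have "P F" by (simp add: P_def)
  then obtain G where G: "P G" and min: "\<And>H. P H \<Longrightarrow> card G \<le> card H"
    using ex_has_least_nat[of P F card] by blast
  have finG: "finite G" using G \<open>finite F\<close> finite_subset P_def by blast
  obtain lo hi where lohi: "\<And>I. I \<in> F \<Longrightarrow> I = {lo I..hi I}"
    using int by metis
  have "card {I \<in> G. x \<in> I} \<le> 2" for x
  proof (rule ccontr)
    define H where "H = {I \<in> G. x \<in> I}"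
    assume "\<not> card {I \<in> G. x \<in> I} \<le> 2"
    then have c: "card H > 2" by (simp add: H_def)
    have finH: "finite H" and neH: "H \<noteq> {}" using finG c by (auto simp: H_def[symmetric]) (simp add: H_def)
    obtain I1 where I1: "I1 \<in> H" "\<And>I. I \<in> H \<Longrightarrow> lo I1 \<le> lo I"
      using ex_min_if_finite[of "lo ` H"] finH neH by (metis (mono_tags, lifting) arg_min_if_finite linorder_le_less_linear)
    obtain I2 where I2: "I2 \<in> H" "\<And>I. I \<in> H \<Longrightarrow> hi I \<le> hi I2"
    proof -
      have "Max (hi ` H) \<in> hi ` H" using finH neH by simp
      then obtain I where "I \<in> H" "hi I = Max (hi ` H)" by force
      then show ?thesis using that finH by (metis Max_ge finite_imageI imageI)
    qed
    have "card {I1, I2} \<le> 2" by (simp add: card_insert_if)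
    then have "\<not> H \<subseteq> {I1, I2}" using c card_mono[of "{I1, I2}" H] by fastforce
    then obtain I3 where I3: "I3 \<in> H" "I3 \<noteq> I1" "I3 \<noteq> I2" by blast
    have "x \<in> I1" "x \<in> I2" using I1 I2 H_def by auto
    have HF: "H \<subseteq> F" using G by (auto simp: H_def P_def)
    have "I3 \<subseteq> I1 \<union> I2"
    proof
      fix y assume "y \<in> I3"
      then have y: "lo I1 \<le> y" "y \<le> hi I2"
        using I1(2)[OF I3(1)] I2(2)[OF I3(1)] lohi[of I3] HF I3(1)
        by (metis atLeastAtMost_iff order_trans subsetD)+
      \<comment> \<open>\<open>I1\<close> and \<open>I2\<close> both contain \<open>x\<close>, so
        \<open>I1\<close> covers the part of \<open>I3\<close> up to \<open>x\<close> and
        \<open>I2\<close> the part beyond.\<close>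
      have x: "lo I2 \<le> x" "x \<le> hi I1"
        using \<open>x \<in> I1\<close> \<open>x \<in> I2\<close> lohi HF I1(1) I2(1) by (metis atLeastAtMost_iff subsetD)+
      have "y \<in> {lo I1..hi I1} \<or> y \<in> {lo I2..hi I2}"
        using x y by (cases "y \<le> x") auto
      then show "y \<in> I1 \<union> I2" using lohi HF I1(1) I2(1) by blast
    qed
    moreover have "I1 \<in> G" "I2 \<in> G" "I3 \<in> G" using I1(1) I2(1) I3(1) H_def by auto
    ultimately have "\<Union>(G - {I3}) = \<Union>G" using I3(2,3) by blast
    then have "P (G - {I3})" using G by (auto simp: P_def)
    from min[OF this] show False using \<open>I3 \<in> G\<close> finG
      by (metis card_Diff1_less linorder_not_less)
  qed
  moreover have "G \<subseteq> F" "\<Union>G = \<Union>F" using G by (simp_all add: P_def)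
  ultimately show ?thesis by (intro that)
qed

section \<open>Densities and elementary bounds for the maximal function\<close>

lemma sum_indicator_eq_card_Int:
  assumes "finite I"
  shows "(\<Sum>i\<in>I. indicator S i :: real) = card (S \<inter> I)"
  using assms by (simp add: Int_commute indicator_def sum.If_cases)

lemma less_maximal_indicatorE:
  assumes "ennreal t < maximal_fun (indicator S) n" "0 \<le> t"
  obtains a b where "a \<le> n" "n \<le> b" "t * card {a..b} < card (S \<inter> {a..b})"
proof -
  from assms obtain I where I: "int_interval I" "n \<in> I"
      "ennreal t < ennreal ((\<Sum>i\<in>I. \<bar>indicator S i :: real\<bar>) / real (card I))"
    by (auto simp: maximal_fun_def less_SUP_iff)
  from I(1) obtain a b where ab: "a \<le> b" "I = {a..b}" by (auto simp: int_interval_def)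
  have "card I > 0" using ab by simp
  have "t < card (S \<inter> I) / card I"
    using I(3) assms(2) ab by (simp add: sum_indicator_eq_card_Int ennreal_less_iff)
  then have "t * card I < card (S \<inter> I)" using \<open>card I > 0\<close> by (simp add: field_simps)
  with that I(2) ab show ?thesis by auto
qed

lemma maximal_indicator_ge:
  assumes "a \<le> n" "n \<le> b"
  shows "ennreal (card (S \<inter> {a..b}) / card {a..b}) \<le> maximal_fun (indicator S) n"
proof -
  have "ennreal ((\<Sum>i\<in>{a..b}. \<bar>indicator S i :: real\<bar>) / real (card {a..b})) \<le> maximal_fun (indicator S) n"
    unfolding maximal_fun_def using assms by (intro SUP_upper) (auto simp: int_interval_def)
  then show ?thesis by (simp add: sum_indicator_eq_card_Int)
qed

lemma maximal_indicator_le_1: "maximal_fun (indicator S) n \<le> 1"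
  unfolding maximal_fun_def
proof (rule SUP_least, clarify)
  fix I assume "int_interval I"
  then obtain a b where ab: "a \<le> b" "I = {a..b}" by (auto simp: int_interval_def)
  have "card (S \<inter> I) \<le> card I" using ab by (intro card_mono) auto
  then show "ennreal ((\<Sum>i\<in>I. \<bar>indicator S i :: real\<bar>) / real (card I)) \<le> 1"
    using ab by (simp add: sum_indicator_eq_card_Int ennreal_le_1 divide_le_eq)
qed

lemma maximal_indicator_eq_1: "n \<in> S \<Longrightarrow> maximal_fun (indicator S) n = 1"
  using maximal_indicator_ge[of n n n S] maximal_indicator_le_1[of S n] by simp

lemma maximal_indicator_empty: "maximal_fun (indicator {}) n = 0"
  by (simp add: maximal_fun_def image_constant_conv bot_ennreal)

lemma maximal_indicator_eq_ennreal:
  "maximal_fun (indicator S) n = ennreal (enn2real (maximal_fun (indicator S) n))"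
  using maximal_indicator_le_1[of S n]
  by (metis ennreal_enn2real_if ennreal_one_less_top linorder_not_less)

section \<open>Cardinality of superlevel sets\<close>

text \<open>A point outside \<open>S\<close> is covered at least once and a point of \<open>S\<close> at most twice by the
  intervals of the subcover; this asymmetry yields the factor \<open>1 - t\<close>, without which the strong
  type bound would not be sharp.\<close>

lemma superlevel_card_outside_le:
  fixes S D :: "int set" and t :: real
  assumes "finite S" "finite D" "0 \<le> t" "t \<le> 1" "D \<inter> S = {}"
    and D: "\<And>n. n \<in> D \<Longrightarrow> ennreal t < maximal_fun (indicator S) n"
  shows "t * card D \<le> 2 * (1 - t) * card S"
proof -
  have "\<exists>a b. n \<in> {a..b} \<and> t * card {a..b} < card (S \<inter> {a..b})" if "n \<in> D" for n
    using less_maximal_indicatorE[OF D[OF that] \<open>0 \<le> t\<close>] by (metis atLeastAtMost_iff)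
  then obtain a b where ab: "\<And>n. n \<in> D \<Longrightarrow> n \<in> {a n..b n}"
      "\<And>n. n \<in> D \<Longrightarrow> t * card {a n..b n} < card (S \<inter> {a n..b n})" by metis
  obtain G where G: "G \<subseteq> (\<lambda>n. {a n..b n}) ` D" "\<Union>G = (\<Union>n\<in>D. {a n..b n})"
      "\<And>x. card {I \<in> G. x \<in> I} \<le> 2"
    using finite_interval_subcover[of "(\<lambda>n. {a n..b n}) ` D"] \<open>finite D\<close> by blast
  define c where "c x = card {I \<in> G. x \<in> I}" for x
  \<comment> \<open>Including \<open>S\<close> lets the sum over \<open>U\<close> split into one
    over all of \<open>S\<close> and one over \<open>U - S\<close>; points of \<open>S\<close>
    outside the cover have multiplicity 0.\<close>
  define U where "U = \<Union>G \<union> S"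
  have finG: "finite G" using G(1) \<open>finite D\<close> finite_surj by blast
  have finI: "finite I" if "I \<in> G" for I using G(1) that by auto
  have finU: "finite U" using finG finI \<open>finite S\<close> by (auto simp: U_def)
  have DU: "D \<subseteq> U - S" using ab(1) G(2) assms(5) by (fastforce simp: U_def)
  have c1: "1 \<le> c x" if "x \<in> D" for x
  proof -
    have "x \<in> \<Union>G" using G(2) ab(1) that by blast
    then have "{I \<in> G. x \<in> I} \<noteq> {}" by blast
    then show ?thesis using finG by (simp add: c_def Suc_le_eq card_gt_0_iff)
  qed
  have "0 \<le> (\<Sum>I\<in>G. \<Sum>x\<in>I. indicator S x - t)"
  proof (rule sum_nonneg)
    fix I assume "I \<in> G"
    then have "t * card I \<le> card (S \<inter> I)" using G(1) ab(2) by fastforce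
    moreover have "(\<Sum>x\<in>I. indicator S x :: real) = card (S \<inter> I)"
      using sum_indicator_eq_card_Int[OF finI[OF \<open>I \<in> G\<close>], of S] by simp
    ultimately show "0 \<le> (\<Sum>x\<in>I. indicator S x - t)"
      by (simp add: sum_subtractf mult.commute)
  qed
  also have "\<dots> = (\<Sum>I\<in>G. \<Sum>x | x \<in> U \<and> x \<in> I. indicator S x - t)"
    by (intro sum.cong refl) (auto simp: U_def)
  also have "\<dots> = (\<Sum>x\<in>U. \<Sum>I | I \<in> G \<and> x \<in> I. indicator S x - t)"
    by (rule sum.swap_restrict[OF finG finU])
  also have "\<dots> = (\<Sum>x\<in>U. c x * (indicator S x - t))" by (simp add: c_def)
  also have "\<dots> = (\<Sum>x\<in>U-S. - (c x * t)) + (\<Sum>x\<in>S. c x * (1 - t))"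
    using sum.subset_diff[of S U "\<lambda>x. c x * (indicator S x - t)"] finU by (simp add: U_def)
  also have "(\<Sum>x\<in>S. c x * (1 - t)) \<le> (\<Sum>x\<in>S. 2 * (1 - t))"
    using G(3) \<open>t \<le> 1\<close> by (intro sum_mono mult_right_mono) (auto simp: c_def)
  \<comment> \<open>Outside \<open>S\<close> all terms are nonpositive, so discarding points not in
    \<open>D\<close> cannot decrease the sum.\<close>
  also have "(\<Sum>x\<in>U-S. - (c x * t)) \<le> (\<Sum>x\<in>D. - (c x * t))"
  proof -
    have "(\<Sum>x\<in>D. c x * t) \<le> (\<Sum>x\<in>U-S. c x * t)"
      using finU DU \<open>0 \<le> t\<close> by (intro sum_mono2) auto
    then show ?thesis by (simp add: sum_negf)
  qed
  also have "(\<Sum>x\<in>D. - (c x * t)) \<le> (\<Sum>x\<in>D. - t)"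
    using c1 \<open>0 \<le> t\<close> by (intro sum_mono) (simp add: mult_le_cancel_right1)
  finally show ?thesis by (simp add: algebra_simps)
qed

text \<open>Let the level increase to \<open>t\<close> in the strict version; both sides are
  continuous in it. The closed form is needed when \<open>t\<close> is the least value on
  \<open>D\<close>, where the strict inequality fails. No smaller nonnegative level exists for
  \<open>t = 0\<close>, but there the claim is trivial.\<close>

lemma superlevel_card_outside_le_closed:
  fixes S D :: "int set" and t :: real
  assumes "finite S" "finite D" "0 \<le> t" "t \<le> 1" "D \<inter> S = {}"
    and D: "\<And>n. n \<in> D \<Longrightarrow> ennreal t \<le> maximal_fun (indicator S) n"
  shows "t * card D \<le> 2 * (1 - t) * card S"
proof (cases "t = 0")
  case False
  have "eventually (\<lambda>u. u * card D \<le> 2 * (1 - u) * card S) (at_left t)"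
    using eventually_at_left_real[of 0 t]
  proof (rule eventually_mono)
    fix u assume u: "u \<in> {0<..<t}"
    then have "ennreal u < ennreal t" by (simp add: ennreal_less_iff)
    then show "u * card D \<le> 2 * (1 - u) * card S"
      using u assms by (intro superlevel_card_outside_le) (auto intro: less_le_trans)
  qed (use False assms in simp)
  then show ?thesis
    by (rule tendsto_le[rotated 3]) (auto intro!: tendsto_intros)
qed simp

text \<open>Points of \<open>S\<close> add at most \<open>t |S|\<close> to the
  \<open>2 (1 - t) |S|\<close> from outside, which makes \<open>(2 - t) |S|\<close>. This is the
  weak type bound.\<close>

lemma superlevel_card_le:
  fixes S D :: "int set" and t :: real
  assumes "finite S" "finite D" "0 \<le> t"
    and D: "\<And>n. n \<in> D \<Longrightarrow> ennreal t < maximal_fun (indicator S) n"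
  shows "t * card D \<le> 2 * card S"
proof (cases "D = {}")
  case False
  then obtain n where "n \<in> D" by blast
  \<comment> \<open>A point of \<open>D\<close> forces \<open>t < 1\<close>, as the maximal function
    never exceeds 1; the outside estimate assumes \<open>t \<le> 1\<close>.\<close>
  then have "ennreal t < 1" using D maximal_indicator_le_1 by (metis less_le_trans)
  then have "t \<le> 1" using \<open>0 \<le> t\<close> by simp
  then have "t * card (D - S) \<le> 2 * (1 - t) * card S"
    using assms by (intro superlevel_card_outside_le) auto
  moreover have "card D \<le> card (D - S) + card S"
    using card_mono[of "(D - S) \<union> S" D] card_Un_le[of "D - S" S] assms by fastforce
  then have "t * card D \<le> t * (card (D - S) + card S)"
    using \<open>0 \<le> t\<close> by (intro mult_left_mono) (auto simp flip: of_nat_add)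
  moreover have "t * card S \<ge> 0" using \<open>0 \<le> t\<close> by simp
  ultimately show ?thesis by (simp add: algebra_simps)
qed simp

section \<open>Comparing power sums with integrals\<close>

text \<open>By the mean value theorem the difference is \<open>(p - 1) * z powr (- p)\<close> for
  some \<open>z\<close> between \<open>x\<close> and \<open>x + 1\<close>, and this decreases in
  \<open>z\<close>. These telescoping differences stand in for integrals.\<close>

lemma powr_telescope:
  fixes x p :: real
  assumes "0 < x" "1 < p"
  shows "(p - 1) * (x + 1) powr (- p) \<le> x powr (1 - p) - (x + 1) powr (1 - p)"
    and "x powr (1 - p) - (x + 1) powr (1 - p) \<le> (p - 1) * x powr (- p)"
proof -
  have "\<exists>z. x < z \<and> z < x + 1 \<and>
      (x + 1) powr (1 - p) - x powr (1 - p) = (x + 1 - x) * ((1 - p) * z powr (- p))"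
    using assms by (intro MVT2) (auto intro!: derivative_eq_intros)
  then obtain z where z: "x < z" "z < x + 1"
      "x powr (1 - p) - (x + 1) powr (1 - p) = (p - 1) * z powr (- p)"
    by (auto simp: algebra_simps)
  have "(x + 1) powr (- p) \<le> z powr (- p)" "z powr (- p) \<le> x powr (- p)"
    using z assms by (auto intro!: powr_mono2')
  then show "(p - 1) * (x + 1) powr (- p) \<le> x powr (1 - p) - (x + 1) powr (1 - p)"
    and "x powr (1 - p) - (x + 1) powr (1 - p) \<le> (p - 1) * x powr (- p)"
    using assms z by (auto simp: mult_left_mono)
qed

text \<open>Telescoping from \<open>x\<close> bounds \<open>p - 1\<close> times the sum of
  \<open>(x + k) powr (- p)\<close> by \<open>x powr (1 - p)\<close>; multiplying by
  \<open>x powr p\<close> leaves \<open>x\<close>, uniformly in \<open>K\<close>.\<close>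

lemma sum_powr_le:
  fixes x p :: real
  assumes "0 < x" "1 < p"
  shows "(\<Sum>k=1..K. (x / (x + real k)) powr p) \<le> x / (p - 1)"
proof -
  have "(p - 1) * (\<Sum>k=1..K. (x + real k) powr (- p)) \<le> x powr (1 - p) - (x + real K) powr (1 - p)"
  proof (induction K)
    case (Suc K)
    show ?case using powr_telescope(1)[of "x + real K" p] assms Suc
      by (simp add: algebra_simps)
  qed simp
  also have "\<dots> \<le> x powr (1 - p)" by simp
  finally have "(p - 1) * (\<Sum>k=1..K. (x + real k) powr (- p)) * x powr p \<le> x powr (1 - p) * x powr p"
    by (intro mult_right_mono) auto
  also have "\<dots> = x" using assms by (simp flip: powr_add)
  finally have "(p - 1) * (\<Sum>k=1..K. x powr p * (x + real k) powr (- p)) \<le> x"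
    by (simp add: sum_distrib_left sum_distrib_right algebra_simps)
  moreover have "(\<Sum>k=1..K. x powr p * (x + real k) powr (- p)) = (\<Sum>k=1..K. (x / (x + real k)) powr p)"
    using assms by (intro sum.cong) (auto simp: powr_divide powr_minus divide_simps)
  ultimately show ?thesis using assms by (simp add: field_simps)
qed

text \<open>From below, telescoping starts at \<open>x + 1\<close>. The shift costs the factor
  \<open>(x / (x + 1)) powr (p - 1)\<close>, which tends to 1 for large \<open>x\<close>; truncation
  at \<open>K\<close> costs the subtracted term, which vanishes as \<open>K\<close> grows.\<close>

lemma sum_powr_ge:
  fixes x p :: real
  assumes "0 < x" "1 < p"
  shows "x * ((x / (x + 1)) powr (p - 1) - (x / (x + 1 + real K)) powr (p - 1)) / (p - 1)
           \<le> (\<Sum>k=1..K. (x / (x + real k)) powr p)"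
proof -
  have "(x + 1) powr (1 - p) - (x + 1 + real K) powr (1 - p) \<le> (p - 1) * (\<Sum>k=1..K. (x + real k) powr (- p))"
  proof (induction K)
    case (Suc K)
    show ?case using powr_telescope(2)[of "x + 1 + real K" p] assms Suc
      by (simp add: algebra_simps)
  qed simp
  then have "((x + 1) powr (1 - p) - (x + 1 + real K) powr (1 - p)) * x powr p
      \<le> (p - 1) * (\<Sum>k=1..K. (x + real k) powr (- p)) * x powr p"
    by (intro mult_right_mono) auto
  also have "\<dots> = (p - 1) * (\<Sum>k=1..K. (x / (x + real k)) powr p)"
    using assms by (auto simp: sum_distrib_left sum_distrib_right powr_divide powr_minus divide_simps intro!: sum.cong)
  also have "((x + 1) powr (1 - p) - (x + 1 + real K) powr (1 - p)) * x powr p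
     = x * ((x / (x + 1)) powr (p - 1) - (x / (x + 1 + real K)) powr (p - 1))"
  proof -
    have "x powr p = x * x powr (p - 1)" using assms by (simp add: powr_mult_base)
    moreover have "y powr (1 - p) = 1 / y powr (p - 1)" for y
      using powr_minus_divide[of y "p - 1"] by simp
    ultimately show ?thesis using assms by (simp add: powr_divide right_diff_distrib left_diff_distrib)
  qed
  finally show ?thesis using assms by (simp add: divide_simps mult.commute)
qed

section \<open>Summing powers of the maximal function\<close>

text \<open>Peeling off the smallest value compares the \<open>k\<close>-th largest value of the maximal function
  outside \<open>S\<close> with \<open>2s / (2s + k)\<close>, where \<open>s = |S|\<close>.\<close>

lemma sum_maximal_powr_outside_le:
  fixes S D :: "int set" and p :: real
  assumes "finite S" "S \<noteq> {}" "1 < p" "finite D" "D \<inter> S = {}"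
  shows "(\<Sum>n\<in>D. enn2real (maximal_fun (indicator S) n) powr p)
         \<le> (\<Sum>k=1..card D. (2 * card S / (2 * card S + real k)) powr p)"
  using assms(4,5)
proof (induction "card D" arbitrary: D)
  case (Suc k)
  define g where "g n = enn2real (maximal_fun (indicator S) n)" for n
  have g: "maximal_fun (indicator S) n = ennreal (g n)" for n
    by (simp add: g_def maximal_indicator_eq_ennreal[symmetric])
  have g01: "0 \<le> g n" "g n \<le> 1" for n
  proof -
    show "0 \<le> g n" by (simp add: g_def)
    then show "g n \<le> 1" using maximal_indicator_le_1[of S n] by (simp only: g ennreal_le_1)
  qed
  have "D \<noteq> {}" using Suc by auto
  then have "Min (g ` D) \<in> g ` D" using Suc.prems by simp
  then obtain d where d: "d \<in> D" "g d = Min (g ` D)" by force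
  then have dmin: "g d \<le> g n" if "n \<in> D" for n using that Suc.prems by simp
  have s: "card S > 0" using assms by (simp add: card_gt_0_iff)
  \<comment> \<open>All of \<open>D\<close> has values at least \<open>g d\<close>, so the closed
    estimate applies at this level; solved for \<open>g d\<close> it gives the last term,
    \<open>k = card D\<close>, of the bound.\<close>
  have "g d * card D \<le> 2 * (1 - g d) * card S"
    using dmin g01 Suc.prems assms by (intro superlevel_card_outside_le_closed) (auto simp: g ennreal_leI)
  then have "g d \<le> 2 * card S / (2 * card S + real (card D))"
    using s by (simp add: field_simps)
  then have "g d powr p \<le> (2 * card S / (2 * card S + real (card D))) powr p"
    using g01 assms by (intro powr_mono2) auto
  moreover have "(\<Sum>n\<in>D - {d}. g n powr p) \<le> (\<Sum>k=1..card (D - {d}). (2 * card S / (2 * card S + real k)) powr p)"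
    unfolding g_def using Suc d by (intro Suc.hyps) auto
  moreover have "card (D - {d}) = k" using Suc d by simp
  moreover have "(\<Sum>n\<in>D. g n powr p) = g d powr p + (\<Sum>n\<in>D - {d}. g n powr p)"
    using Suc.prems d by (intro sum.remove)
  ultimately show ?case by (simp add: g_def[symmetric] flip: Suc.hyps(2))
qed simp

text \<open>Points of \<open>S\<close> contribute at most \<open>|S|\<close>, those outside at most
  \<open>2 |S| / (p - 1)\<close> by the integral comparison with \<open>x = 2 |S|\<close>. The
  constant arises as \<open>1 + 2 / (p - 1)\<close>.\<close>

lemma sum_maximal_powr_le:
  fixes S D :: "int set" and p :: real
  assumes "finite S" "1 < p" "finite D"
  shows "(\<Sum>n\<in>D. enn2real (maximal_fun (indicator S) n) powr p) \<le> (p + 1) / (p - 1) * card S"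
proof (cases "S = {}")
  case True then show ?thesis by (simp add: maximal_indicator_empty)
next
  case False
  let ?g = "\<lambda>n. enn2real (maximal_fun (indicator S) n) powr p"
  have "card S > 0" using assms False by (simp add: card_gt_0_iff)
  have "(\<Sum>n\<in>D. ?g n) \<le> (\<Sum>n\<in>(D - S) \<union> S. ?g n)"
    using assms by (intro sum_mono2) auto
  also have "\<dots> = (\<Sum>n\<in>D - S. ?g n) + (\<Sum>n\<in>S. ?g n)"
    using assms by (intro sum.union_disjoint) auto
  also have "(\<Sum>n\<in>S. ?g n) = card S" by (simp add: maximal_indicator_eq_1)
  also have "(\<Sum>n\<in>D - S. ?g n) \<le> (\<Sum>k=1..card (D - S). (2 * card S / (2 * card S + real k)) powr p)"
    using assms False by (intro sum_maximal_powr_outside_le) auto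
  also have "\<dots> \<le> 2 * card S / (p - 1)"
    using sum_powr_le[of "2 * card S" p] assms \<open>card S > 0\<close> by simp
  finally show ?thesis using assms by (simp add: field_simps)
qed

section \<open>Extended powers, counting integrals and norms of characteristic functions\<close>

lemma epowr_ennreal [simp]: "0 \<le> x \<Longrightarrow> epowr (ennreal x) a = ennreal (x powr a)"
  by (simp add: epowr_def)

lemma epowr_top [simp]: "epowr \<infinity> a = \<infinity>" "epowr top a = top"
  by (simp_all add: epowr_def)

lemma epowr_zero [simp]: "epowr 0 a = 0"
  by (simp add: epowr_def)

lemma epowr_mono: "x \<le> y \<Longrightarrow> 0 \<le> a \<Longrightarrow> epowr x a \<le> epowr y a"
  by (cases x; cases y) (auto simp: powr_mono2 ennreal_leI top_unique)

lemma epowr_one [simp]: "epowr x 1 = x"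
  by (cases x) auto

lemma epowr_indicator: "epowr (indicator S n) a = indicator S n"
  by (auto simp: epowr_def indicator_def)

text \<open>Enumerating the integers by \<open>int_decode\<close> turns the integral into a series
  whose partial sums are sums over finite sets. Thus bounds for finite \<open>D\<close> carry over
  to norms.\<close>

lemma nn_integral_count_space_int_le:
  fixes f :: "int \<Rightarrow> ennreal"
  assumes "\<And>D. finite D \<Longrightarrow> sum f D \<le> C"
  shows "(\<integral>\<^sup>+ n. f n \<partial>count_space UNIV) \<le> C"
proof -
  have "(\<integral>\<^sup>+ n. f n \<partial>count_space UNIV) = (\<integral>\<^sup>+ k. f (int_decode k) \<partial>count_space UNIV)"
    by (rule nn_integral_bij_count_space[OF bij_int_decode, symmetric])
  also have "\<dots> = (\<Sum>k. f (int_decode k))" by (rule nn_integral_count_space_nat)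
  also have "\<dots> \<le> C"
  proof (rule suminf_le_const)
    fix N
    have "(\<Sum>k<N. f (int_decode k)) = sum f (int_decode ` {..<N})"
      by (simp add: sum.reindex inj_int_decode)
    also have "\<dots> \<le> C" by (intro assms) simp
    finally show "(\<Sum>k<N. f (int_decode k)) \<le> C" .
  qed simp
  finally show ?thesis .
qed

lemma sum_le_nn_integral_count_space:
  fixes f :: "'a \<Rightarrow> ennreal"
  assumes "finite D"
  shows "sum f D \<le> (\<integral>\<^sup>+ n. f n \<partial>count_space UNIV)"
proof -
  have "sum f D = (\<integral>\<^sup>+ n. f n \<partial>count_space D)"
    using assms by (simp add: nn_integral_count_space_finite)
  also have "\<dots> = (\<integral>\<^sup>+ n. f n * indicator D n \<partial>count_space UNIV)"
    by (simp add: nn_integral_count_space_indicator)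
  also have "\<dots> \<le> (\<integral>\<^sup>+ n. f n \<partial>count_space UNIV)"
    by (intro nn_integral_mono) (auto simp: indicator_def)
  finally show ?thesis .
qed

lemma lp_norm_indicator:
  assumes "p \<noteq> \<infinity>"
  shows "lp_norm p (indicator S) = epowr (emeasure (count_space UNIV) S) (1 / enn2real p)"
  using assms by (simp add: lp_norm_def epowr_indicator)

lemma lp_norm_indicator_finite:
  assumes "finite S" "0 \<le> q"
  shows "lp_norm (ennreal q) (indicator S) = ennreal (card S powr (1 / q))"
  using assms by (simp add: lp_norm_indicator emeasure_count_space_finite flip: ennreal_of_nat_eq_real_of_nat)
    (simp add: ennreal_of_nat_eq_real_of_nat)

lemma lp_norm_indicator_less_top_iff:
  "lp_norm (ennreal q) (indicator S) < \<infinity> \<longleftrightarrow> finite S"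
  by (cases "finite S") (auto simp: lp_norm_indicator emeasure_count_space ennreal_of_nat_eq_real_of_nat)

lemma epowr_maximal_indicator:
  "epowr (maximal_fun (indicator S) n) q
     = ennreal (enn2real (maximal_fun (indicator S) n) powr q)"
  by (subst maximal_indicator_eq_ennreal) simp

section \<open>Strong type upper bound\<close>

lemma lp_norm_maximal_le:
  assumes "finite S" "1 < q"
  shows "lp_norm (ennreal q) (maximal_fun (indicator S))
         \<le> ennreal (((q + 1) / (q - 1)) powr (1 / q)) * lp_norm (ennreal q) (indicator S)"
proof -
  have "(\<integral>\<^sup>+ n. epowr (maximal_fun (indicator S) n) q \<partial>count_space UNIV)
        \<le> ennreal ((q + 1) / (q - 1) * card S)"
  proof (rule nn_integral_count_space_int_le)
    fix D :: "int set" assume "finite D"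
    then show "(\<Sum>n\<in>D. epowr (maximal_fun (indicator S) n) q) \<le> ennreal ((q + 1) / (q - 1) * card S)"
      unfolding epowr_maximal_indicator using sum_maximal_powr_le[of S q D] assms
      by (simp add: sum_ennreal ennreal_leI)
  qed
  then have "lp_norm (ennreal q) (maximal_fun (indicator S))
      \<le> epowr (ennreal ((q + 1) / (q - 1) * card S)) (1 / q)"
    using assms by (simp add: lp_norm_def epowr_mono del: times_divide_eq_left epowr_ennreal)
  also have "\<dots> = ennreal (((q + 1) / (q - 1)) powr (1 / q)) * lp_norm (ennreal q) (indicator S)"
    using assms
    by (subst epowr_ennreal) (auto simp: lp_norm_indicator_finite powr_mult ennreal_mult simp del: times_divide_eq_left)
  finally show ?thesis .
qed

section \<open>Lower bounds from intervals\<close>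

text \<open>At distance \<open>k\<close> from \<open>{1..int m}\<close>, on either side, the
  interval reaching to the far end of this set has density \<open>m / (m + k)\<close>; the two sides
  give the factor 2. The bound serves both for the divergence at exponent 1 and for the sharp
  constant.\<close>

lemma maximal_interval_powr_sum_le:
  fixes m K :: nat
  assumes "1 \<le> q"
  shows "ennreal (m + 2 * (\<Sum>k=1..K. (real m / (real m + real k)) powr q))
         \<le> (\<integral>\<^sup>+ n. epowr (maximal_fun (indicator {1..int m}) n) q \<partial>count_space UNIV)"
proof -
  let ?f = "\<lambda>n. epowr (maximal_fun (indicator {1..int m}) n) q"
  define h where "h k = (real m / (real m + real k)) powr q" for k :: nat
  \<comment> \<open>Points to the left and to the right; starting at \<open>k = 1\<close> keeps both
    sets disjoint from \<open>{1..int m}\<close>.\<close>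
  define L R where "L = (\<lambda>k. 1 - int k) ` {1..K}" and "R = (\<lambda>k. int m + int k) ` {1..K}"
  have l: "ennreal (h k) \<le> ?f (1 - int k)" for k
  proof -
    have "{1..int m} \<inter> {1 - int k..int m} = {1..int m}" by auto
    moreover have "card {1 - int k..int m} = m + k" by simp
    ultimately have "ennreal (real m / (real m + real k)) \<le> maximal_fun (indicator {1..int m}) (1 - int k)"
      using maximal_indicator_ge[of "1 - int k" "1 - int k" "int m" "{1..int m}"]
      by (cases "m + k = 0") (auto simp: add.commute)
    then have "epowr (ennreal (real m / (real m + real k))) q \<le> ?f (1 - int k)"
      using assms by (intro epowr_mono) auto
    then show ?thesis by (simp add: h_def)
  qed
  have r: "ennreal (h k) \<le> ?f (int m + int k)" for k
  \<comment> \<open>For \<open>m = k = 0\<close> the quotient is \<open>0 / 0 = 0\<close> and the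
    bound is trivial.\<close>
  proof (cases "m + k = 0")
    case False
    have "{1..int m} \<inter> {1..int m + int k} = {1..int m}" by auto
    moreover have "card {1..int m + int k} = m + k" by (simp add: nat_add_distrib)
    ultimately have "ennreal (real m / (real m + real k)) \<le> maximal_fun (indicator {1..int m}) (int m + int k)"
      using maximal_indicator_ge[of 1 "int m + int k" "int m + int k" "{1..int m}"] False
      by (auto simp: add.commute)
    then have "epowr (ennreal (real m / (real m + real k))) q \<le> ?f (int m + int k)"
      using assms by (intro epowr_mono) auto
    then show ?thesis by (simp add: h_def)
  qed (simp add: h_def)
  have "ennreal (m + 2 * (\<Sum>k=1..K. h k)) = ennreal m + (\<Sum>k=1..K. ennreal (h k)) + (\<Sum>k=1..K. ennreal (h k))"
    by (simp add: sum_ennreal h_def sum_nonneg flip: ennreal_plus)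
  also have "\<dots> \<le> sum ?f {1..int m} + sum ?f L + sum ?f R"
  proof (intro add_mono)
    show "ennreal m \<le> sum ?f {1..int m}"
      by (simp add: maximal_indicator_eq_1 epowr_def ennreal_of_nat_eq_real_of_nat)
    show "(\<Sum>k=1..K. ennreal (h k)) \<le> sum ?f L"
      unfolding L_def by (subst sum.reindex) (auto simp: inj_on_def intro!: sum_mono l)
    show "(\<Sum>k=1..K. ennreal (h k)) \<le> sum ?f R"
      unfolding R_def by (subst sum.reindex) (auto simp: inj_on_def intro!: sum_mono r)
  qed
  also have "sum ?f {1..int m} + sum ?f L + sum ?f R = sum ?f ({1..int m} \<union> L \<union> R)"
    by (subst sum.union_disjoint; (subst sum.union_disjoint)?) (auto simp: L_def R_def)
  also have "\<dots> \<le> (\<integral>\<^sup>+ n. ?f n \<partial>count_space UNIV)"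
    by (intro sum_le_nn_integral_count_space) (auto simp: L_def R_def)
  finally show ?thesis by (simp add: h_def)
qed

text \<open>The maximal function decays no faster than \<open>m / (m + k)\<close>, so a finite norm
  would bound the partial sums of a tail of the harmonic series.\<close>

lemma lp_norm_1_maximal_interval:
  assumes "1 \<le> m"
  shows "lp_norm 1 (maximal_fun (indicator {1..int m})) = \<infinity>"
proof -
  let ?N = "\<integral>\<^sup>+ n. epowr (maximal_fun (indicator {1..int m}) n) 1 \<partial>count_space UNIV"
  have "?N = \<infinity>"
  proof (rule ccontr)
    assume "?N \<noteq> \<infinity>"
    then obtain r where r: "?N = ennreal r" "0 \<le> r" by (cases ?N) auto
    have "summable (\<lambda>k. 1 / real (k + Suc m))"
    proof (rule summableI_nonneg_bounded)
      fix K
      have "ennreal (m + 2 * (\<Sum>k=1..K. real m / (real m + real k))) \<le> ennreal r"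
        using maximal_interval_powr_sum_le[of 1 m K] r by simp
      then have le: "m + 2 * (\<Sum>k=1..K. real m / (real m + real k)) \<le> r"
        using r by simp
      have "(\<Sum>k<K. 1 / real (k + Suc m)) = (\<Sum>k=1..K. 1 / (real m + real k))"
        by (rule sum.reindex_bij_witness[of _ "\<lambda>k. k - 1" Suc]) (auto simp: add_ac)
      also have "\<dots> \<le> (\<Sum>k=1..K. real m / (real m + real k))"
        using assms by (intro sum_mono divide_right_mono) auto
      also have "\<dots> \<le> r"
      proof -
        have "0 \<le> (\<Sum>k=1..K. real m / (real m + real k))" by (intro sum_nonneg) simp
        then show ?thesis using le by linarith
      qed
      finally show "(\<Sum>k<K. 1 / real (k + Suc m)) \<le> r" .
    qed simp
    then show False
      using summable_iff_shift[of "\<lambda>k. 1 / real k" "Suc m"] not_summable_harmonic[where 'a=real]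
      by (simp add: inverse_eq_divide)
  qed
  then show ?thesis by (simp add: lp_norm_def)
qed

text \<open>Here \<open>K\<close> tends to infinity while \<open>m\<close> stays fixed; the
  remaining loss \<open>(m / (m + 1)) powr (q - 1)\<close> disappears only as \<open>m\<close>
  grows.\<close>

lemma lp_norm_maximal_interval_ge:
  assumes "1 \<le> m" "1 < q"
  shows "ennreal ((1 + 2 * (real m / (real m + 1)) powr (q - 1) / (q - 1)) powr (1 / q))
           * lp_norm (ennreal q) (indicator {1..int m})
         \<le> lp_norm (ennreal q) (maximal_fun (indicator {1..int m}))"
proof -
  let ?N = "\<integral>\<^sup>+ n. epowr (maximal_fun (indicator {1..int m}) n) q \<partial>count_space UNIV"
  let ?c = "1 + 2 * (real m / (real m + 1)) powr (q - 1) / (q - 1)"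
  have "0 \<le> ?c" using assms by (intro add_nonneg_nonneg) auto
  have "(\<lambda>K. real m + 2 * (m * ((m / (m + 1)) powr (q - 1) - (m / (m + 1 + real K)) powr (q - 1)) / (q - 1)))
      \<longlonglongrightarrow> real m + 2 * (m * ((m / (m + 1)) powr (q - 1) - 0) / (q - 1))"
  proof (intro tendsto_intros)
    have "(\<lambda>K. real m / (m + 1 + real K)) \<longlonglongrightarrow> 0"
      by (intro tendsto_divide_0[OF tendsto_const] filterlim_at_top_imp_at_infinity
          filterlim_tendsto_add_at_top[OF tendsto_const] filterlim_real_sequentially)
    \<comment> \<open>The truncation term vanishes because the exponent \<open>q - 1\<close> is
      positive.\<close>
    then have "(\<lambda>K. (real m / (m + 1 + real K)) powr (q - 1)) \<longlonglongrightarrow> 0 powr (q - 1)"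
      using assms by (intro tendsto_powr') auto
    then show "(\<lambda>K. (real m / (m + 1 + real K)) powr (q - 1)) \<longlonglongrightarrow> 0" by simp
  qed (use assms in auto)
  moreover have "real m + 2 * (m * ((m / (m + 1)) powr (q - 1) - 0) / (q - 1)) = m * ?c"
    by (simp add: algebra_simps)
  ultimately have "(\<lambda>K. real m + 2 * (m * ((m / (m + 1)) powr (q - 1)
      - (m / (m + 1 + real K)) powr (q - 1)) / (q - 1))) \<longlonglongrightarrow> m * ?c" by (simp only:)
  then have lim: "(\<lambda>K. ennreal (real m + 2 * (m * ((m / (m + 1)) powr (q - 1)
      - (m / (m + 1 + real K)) powr (q - 1)) / (q - 1)))) \<longlonglongrightarrow> ennreal (m * ?c)"
    by (rule tendsto_ennrealI)
  have "ennreal (m * ?c) \<le> ?N"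
  proof (rule LIMSEQ_le_const2[OF lim], intro exI allI impI)
    fix K
    have "ennreal (real m + 2 * (m * ((m / (m + 1)) powr (q - 1) - (m / (m + 1 + real K)) powr (q - 1)) / (q - 1)))
      \<le> ennreal (m + 2 * (\<Sum>k=1..K. (real m / (real m + real k)) powr q))"
      using sum_powr_ge[of "real m" q K] assms by (intro ennreal_leI) (simp add: add.commute)
    also have "\<dots> \<le> ?N" using assms by (intro maximal_interval_powr_sum_le) auto
    finally show "ennreal (real m + 2 * (m * ((m / (m + 1)) powr (q - 1)
      - (m / (m + 1 + real K)) powr (q - 1)) / (q - 1))) \<le> ?N" .
  qed
  then have "epowr (ennreal (m * ?c)) (1 / q) \<le> lp_norm (ennreal q) (maximal_fun (indicator {1..int m}))"
    using assms by (simp add: lp_norm_def epowr_mono del: epowr_ennreal)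
  moreover have "epowr (ennreal (m * ?c)) (1 / q) = ennreal (?c powr (1 / q)) * lp_norm (ennreal q) (indicator {1..int m})"
    using assms \<open>0 \<le> ?c\<close>
    by (simp add: lp_norm_indicator_finite powr_mult mult.commute flip: ennreal_mult)
  ultimately show ?thesis by simp
qed

section \<open>Weak type bound and its extremizer\<close>

lemma weak_norm_maximal_le:
  assumes "finite S" "1 \<le> q"
  shows "weak_norm (ennreal q) (maximal_fun (indicator S))
         \<le> ennreal (2 powr (1 / q)) * lp_norm (ennreal q) (indicator S)"
proof -
  have "epowr (ennreal t * emeasure (count_space UNIV) {n. ennreal t < maximal_fun (indicator S) n}) (1 / q)
        \<le> ennreal (2 powr (1 / q)) * lp_norm (ennreal q) (indicator S)" if "0 < t" for t
  proof -
    define E where "E = {n. ennreal t < maximal_fun (indicator S) n}"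
    have bound: "t * card D \<le> 2 * card S" if "finite D" "D \<subseteq> E" for D
      using that assms \<open>0 < t\<close> superlevel_card_le[of S D t] by (auto simp: E_def)
    \<comment> \<open>A uniform bound on the size of finite subsets excludes an infinite
      \<open>E\<close>, whose counting measure would be infinite.\<close>
    have "finite E"
    proof (rule finite_if_finite_subsets_card_bdd[THEN conjunct1])
      fix D assume "D \<subseteq> E" "finite D"
      then have "real (card D) \<le> 2 * card S / t" using bound[of D] \<open>0 < t\<close> by (simp add: field_simps)
      then show "card D \<le> nat \<lfloor>2 * card S / t\<rfloor>" by (simp add: le_nat_floor)
    qed
    then have "ennreal t * emeasure (count_space UNIV) E = ennreal (t * card E)"
      using \<open>0 < t\<close> by (simp add: ennreal_mult ennreal_of_nat_eq_real_of_nat)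
    also have "\<dots> \<le> ennreal (2 * card S)"
      using bound[OF \<open>finite E\<close>] by (intro ennreal_leI) simp
    finally have "epowr (ennreal t * emeasure (count_space UNIV) E) (1 / q) \<le> epowr (ennreal (2 * card S)) (1 / q)"
      using assms by (intro epowr_mono) auto
    also have "\<dots> = ennreal (2 powr (1 / q)) * lp_norm (ennreal q) (indicator S)"
      using assms by (subst epowr_ennreal) (auto simp: lp_norm_indicator_finite powr_mult ennreal_mult)
    finally show ?thesis by (simp add: E_def)
  qed
  then show ?thesis using assms by (auto simp: weak_norm_def intro!: SUP_least)
qed

text \<open>The upper bound is the general one. For the lower one, the maximal function is at least
  \<open>1 / (k + 1)\<close> at the \<open>2 * k + 1\<close> points within distance \<open>k\<close>
  of 0; the product of level and cardinality approaches 2 as \<open>k\<close> grows.\<close>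

lemma weak_norm_maximal_singleton:
  assumes "1 \<le> q"
  shows "weak_norm (ennreal q) (maximal_fun (indicator {0})) = ennreal (2 powr (1 / q))"
proof (rule antisym)
  show "weak_norm (ennreal q) (maximal_fun (indicator {0})) \<le> ennreal (2 powr (1 / q))"
    using weak_norm_maximal_le[of "{0}" q] assms by (simp add: lp_norm_indicator_finite)
next
  let ?W = "weak_norm (ennreal q) (maximal_fun (indicator {0}))"
  have *: "ennreal (((2 * real k + 1) / (real k + 2)) powr (1 / q)) \<le> ?W" for k :: nat
  proof -
    \<comment> \<open>Superlevel sets are strict, so the level must lie below
      \<open>1 / (k + 1)\<close>; this choice does not affect the limit.\<close>
    define t where "t = 1 / (real k + 2)"
    define E where "E = {n. ennreal t < maximal_fun (indicator {0}) n}"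
    have "0 < t" by (simp add: t_def)
    have "{- int k..int k} \<subseteq> E"
    proof
      fix n assume n: "n \<in> {- int k..int k}"
      \<comment> \<open>The shortest interval containing \<open>n\<close> and 0; it has at most
        \<open>k + 1\<close> points.\<close>
      define a b where "a = min n 0" and "b = max n 0"
      have ab: "a \<le> n" "n \<le> b" "a \<le> 0" "0 \<le> b" "b - a \<le> int k" "a \<le> b"
        using n by (auto simp: a_def b_def)
      have "t < 1 / (real k + 1)" by (simp add: t_def frac_less2)
      also have "\<dots> \<le> 1 / card {a..b}" using ab by (intro divide_left_mono) auto
      also have "\<dots> = card ({0} \<inter> {a..b}) / card {a..b}" using ab by simp
      finally have "ennreal t < ennreal (card ({0} \<inter> {a..b}) / card {a..b})"
        using \<open>0 < t\<close> by (simp only: ennreal_less_iff less_imp_le)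
      also have "\<dots> \<le> maximal_fun (indicator {0}) n" using ab by (intro maximal_indicator_ge)
      finally show "n \<in> E" by (simp add: E_def)
    qed
    then have "emeasure (count_space UNIV) {- int k..int k} \<le> emeasure (count_space UNIV) E"
      by (intro emeasure_mono) auto
    then have le: "ennreal (2 * real k + 1) \<le> emeasure (count_space UNIV) E"
      by (simp add: ennreal_of_nat_eq_real_of_nat)
    have "ennreal ((2 * real k + 1) / (real k + 2)) = ennreal t * ennreal (2 * real k + 1)"
      by (subst ennreal_mult[symmetric]) (auto simp: t_def)
    also have "\<dots> \<le> ennreal t * emeasure (count_space UNIV) E" by (intro mult_left_mono le) simp
    finally have "epowr (ennreal ((2 * real k + 1) / (real k + 2))) (1 / q)
        \<le> epowr (ennreal t * emeasure (count_space UNIV) E) (1 / q)"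
      using assms by (intro epowr_mono) auto
    also have "\<dots> \<le> ?W"
      using assms \<open>0 < t\<close> by (auto simp: weak_norm_def E_def intro!: SUP_upper)
    finally show ?thesis by simp
  qed
  have "(\<lambda>k. (2 * real k + 1) / (real k + 2)) \<longlonglongrightarrow> 2"
  proof -
    have "(\<lambda>k. 3 / (2 + real k)) \<longlonglongrightarrow> 0"
      by (intro tendsto_divide_0[OF tendsto_const] filterlim_at_top_imp_at_infinity
          filterlim_tendsto_add_at_top[OF tendsto_const] filterlim_real_sequentially)
    then have "(\<lambda>k. 2 - 3 / (2 + real k)) \<longlonglongrightarrow> 2 - 0" by (intro tendsto_diff tendsto_const)
    then show ?thesis by (simp add: field_simps)
  qed
  then have "(\<lambda>k. ennreal (((2 * real k + 1) / (real k + 2)) powr (1 / q))) \<longlonglongrightarrow> ennreal (2 powr (1 / q))"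
    by (intro tendsto_ennrealI tendsto_powr) auto
  then show "ennreal (2 powr (1 / q)) \<le> ?W" by (rule LIMSEQ_le_const2) (use * in auto)
qed

section \<open>Identifying the least constants\<close>

text \<open>Every admissible constant dominates the ratios along the intervals, hence their limit;
  so if the limit is itself admissible, it is the least. Positive finite norms justify the
  division.\<close>

lemma C0_eqI:
  assumes le: "\<And>S. lp_norm p (indicator S) < \<infinity> \<Longrightarrow>
      lp_norm p (maximal_fun (indicator S)) \<le> C * lp_norm p (indicator S)"
    and norm: "\<And>m. 1 \<le> m \<Longrightarrow> 0 < lp_norm p (indicator {1..int m}) \<and> lp_norm p (indicator {1..int m}) < \<infinity>"
    and lim: "(\<lambda>m::nat. lp_norm p (maximal_fun (indicator {1..int m})) / lp_norm p (indicator {1..int m}))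
      \<longlonglongrightarrow> C"
  shows "C0 p = C"
  unfolding C0_def
proof (rule Least_equality)
  show "\<forall>S. lp_norm p (indicator S) < \<infinity> \<longrightarrow>
      lp_norm p (maximal_fun (indicator S)) \<le> C * lp_norm p (indicator S)"
    using le by blast
next
  fix C' assume C': "\<forall>S. lp_norm p (indicator S) < \<infinity> \<longrightarrow>
      lp_norm p (maximal_fun (indicator S)) \<le> C' * lp_norm p (indicator S)"
  show "C \<le> C'"
  proof (rule LIMSEQ_le_const2[OF lim], intro exI allI impI)
    fix m :: nat assume "1 \<le> m"
    then show "lp_norm p (maximal_fun (indicator {1..int m})) / lp_norm p (indicator {1..int m}) \<le> C'"
      using C' norm[of m] by (intro divide_le_posI_ennreal) (auto simp: mult.commute)
  qed
qed

lemma C0_weak_eqI: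
  assumes le: "\<And>S. lp_norm p (indicator S) < \<infinity> \<Longrightarrow>
      weak_norm p (maximal_fun (indicator S)) \<le> C * lp_norm p (indicator S)"
    and "lp_norm p (indicator {0}) = 1" "weak_norm p (maximal_fun (indicator {0})) = C"
  shows "C0_weak p = C"
  unfolding C0_weak_def
proof (rule Least_equality)
  fix C' assume "\<forall>S. lp_norm p (indicator S) < \<infinity> \<longrightarrow>
      weak_norm p (maximal_fun (indicator S)) \<le> C' * lp_norm p (indicator S)"
  then show "C \<le> C'" using assms(2,3) by (metis ennreal_one_less_top infinity_ennreal_def mult.right_neutral)
qed (use le in blast)

section \<open>Norms at the upper endpoint and ratios along intervals\<close>

lemma lp_norm_top_indicator: "lp_norm top (indicator S) = (if S = {} then 0 else 1)"
proof (cases "S = {}")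
  case False
  then obtain n where "n \<in> S" by blast
  then have "(SUP n. indicator S n) = (1 :: ennreal)"
    by (intro antisym SUP_least) (auto simp: indicator_def intro: SUP_upper2[of n])
  then show ?thesis using False by (simp add: lp_norm_def)
qed (simp add: lp_norm_def)

lemma lp_norm_top_maximal:
  "lp_norm top (maximal_fun (indicator S)) = (if S = {} then 0 else 1)"
proof (cases "S = {}")
  case False
  then obtain n where "n \<in> S" by blast
  then have "(SUP n. maximal_fun (indicator S) n) = 1"
    by (intro antisym SUP_least maximal_indicator_le_1)
      (auto simp: maximal_indicator_eq_1 intro: SUP_upper2[of n])
  then show ?thesis using False by (simp add: lp_norm_def)
qed (simp add: lp_norm_def maximal_indicator_empty)

text \<open>The ratios are squeezed between the lower bound for intervals and the general upper
  bound; both limits agree as \<open>1 + 2 / (q - 1) = (q + 1) / (q - 1)\<close>.\<close>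

lemma tendsto_ratio_intervals:
  assumes "1 < q"
  shows "(\<lambda>m::nat. lp_norm (ennreal q) (maximal_fun (indicator {1..int m}))
            / lp_norm (ennreal q) (indicator {1..int m}))
         \<longlonglongrightarrow> ennreal (((q + 1) / (q - 1)) powr (1 / q))"
proof (rule tendsto_sandwich)
  let ?L = "\<lambda>m. (1 + 2 * (real m / (real m + 1)) powr (q - 1) / (q - 1)) powr (1 / q)"
  have pos: "0 < real m powr (1 / q)" if "1 \<le> m" for m :: nat using that by simp
  show "\<forall>\<^sub>F m in sequentially. lp_norm (ennreal q) (maximal_fun (indicator {1..int m}))
      / lp_norm (ennreal q) (indicator {1..int m}) \<le> ennreal (((q + 1) / (q - 1)) powr (1 / q))"
    \<comment> \<open>The index \<open>m = 0\<close> is left out: \<open>{1..int 0}\<close> is empty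
      and has norm 0.\<close>
    using eventually_ge_at_top[of 1]
  proof eventually_elim
    case (elim m)
    then show ?case using lp_norm_maximal_le[of "{1..int m}" q] assms pos[OF elim]
      by (intro divide_le_posI_ennreal) (auto simp: lp_norm_indicator_finite mult.commute)
  qed
  show "\<forall>\<^sub>F m in sequentially. ennreal (?L m) \<le> lp_norm (ennreal q) (maximal_fun (indicator {1..int m}))
      / lp_norm (ennreal q) (indicator {1..int m})"
    using eventually_ge_at_top[of 1]
  proof eventually_elim
    case (elim m)
    have "ennreal (?L m) = ennreal (?L m) * lp_norm (ennreal q) (indicator {1..int m})
        / lp_norm (ennreal q) (indicator {1..int m})"
      using assms pos[OF elim] by (simp add: lp_norm_indicator_finite divide_ennreal flip: ennreal_mult)
    also have "\<dots> \<le> lp_norm (ennreal q) (maximal_fun (indicator {1..int m}))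
        / lp_norm (ennreal q) (indicator {1..int m})"
      using lp_norm_maximal_interval_ge[OF elim assms] by (rule divide_right_mono_ennreal)
    finally show ?case .
  qed
  have "(\<lambda>m. real m / (real m + 1)) \<longlonglongrightarrow> 1"
    using LIMSEQ_n_over_Suc_n[where 'a=real] by (simp add: add.commute)
  then have "?L \<longlonglongrightarrow> (1 + 2 * 1 powr (q - 1) / (q - 1)) powr (1 / q)"
    using assms by (intro tendsto_intros) auto
  also have "1 + 2 * 1 powr (q - 1) / (q - 1) = (q + 1) / (q - 1)"
    using assms by (simp add: field_simps)
  finally show "(\<lambda>m. ennreal (?L m)) \<longlonglongrightarrow> ennreal (((q + 1) / (q - 1)) powr (1 / q))"
    by (rule tendsto_ennrealI)
qed simp

section \<open>Assembly over all exponents\<close>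

theorem theorem2p1:
  fixes p :: ennreal
  assumes "1 \<le> p"
  shows "C0 p =
           (if p = 1 then \<infinity>
            else if p = \<infinity> then 1
            else ennreal (((enn2real p + 1) / (enn2real p - 1)) powr (1 / enn2real p)))
       \<and> C0_weak p =
           (if p = 1 then 2
            else if p = \<infinity> then 1
            else ennreal (2 powr (1 / enn2real p)))
       \<and> weak_norm p (maximal_fun (indicator {0})) = C0_weak p * lp_norm p (indicator {0})
       \<and> (\<lambda>m::nat. lp_norm p (maximal_fun (indicator {1..int m})) / lp_norm p (indicator {1..int m}))
            \<longlonglongrightarrow> C0 p"
proof (cases "p = top")
  case True
  have lim: "(\<lambda>m::nat. lp_norm top (maximal_fun (indicator {1..int m})) / lp_norm top (indicator {1..int m}))
      \<longlonglongrightarrow> 1"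
    by (rule tendsto_eventually, rule eventually_mono[OF eventually_ge_at_top[of 1]])
      (simp add: lp_norm_top_maximal lp_norm_top_indicator)
  have "C0 top = 1"
    by (rule C0_eqI[OF _ _ lim]) (simp_all add: lp_norm_top_maximal lp_norm_top_indicator)
  moreover have weak: "weak_norm top g = lp_norm top g" for g
    by (simp add: weak_norm_def)
  have "C0_weak top = 1"
    by (rule C0_weak_eqI) (simp_all add: weak lp_norm_top_maximal lp_norm_top_indicator)
  ultimately show ?thesis
    using True lim by (simp add: weak lp_norm_top_maximal lp_norm_top_indicator)
next
  case False
  then obtain q where q: "p = ennreal q" "0 \<le> q" by (cases p) auto
  then have "1 \<le> q" using assms by (metis ennreal_1 ennreal_le_iff)
  define C where "C = (if q = 1 then \<infinity> else ennreal (((q + 1) / (q - 1)) powr (1 / q)))"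
  have norm: "0 < lp_norm p (indicator {1..int m}) \<and> lp_norm p (indicator {1..int m}) < \<infinity>"
    if "1 \<le> m" for m
    using that q by (simp add: lp_norm_indicator_finite)
  have lim: "(\<lambda>m::nat. lp_norm p (maximal_fun (indicator {1..int m})) / lp_norm p (indicator {1..int m}))
      \<longlonglongrightarrow> C"
  proof (cases "q = 1")
    case True
    \<comment> \<open>At exponent 1 each single nonempty interval already has infinite
      ratio.\<close>
    have "lp_norm p (maximal_fun (indicator {1..int m})) / lp_norm p (indicator {1..int m}) = C"
      if "1 \<le> m" for m
      using that True q norm[OF that] by (auto simp: C_def lp_norm_1_maximal_interval ennreal_top_divide)
    then show ?thesis by (intro tendsto_eventually eventually_mono[OF eventually_ge_at_top[of 1]])
  next
    case False
    then show ?thesis using \<open>1 \<le> q\<close> q by (simp add: C_def tendsto_ratio_intervals)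
  qed
  have "C0 p = C"
  proof (rule C0_eqI[OF _ norm lim])
    fix S assume "lp_norm p (indicator S) < \<infinity>"
    then have "finite S" using q by (simp add: lp_norm_indicator_less_top_iff del: infinity_ennreal_def)
    show "lp_norm p (maximal_fun (indicator S)) \<le> C * lp_norm p (indicator S)"
    proof (cases "q = 1")
      case True
      show ?thesis
      \<comment> \<open>Since \<open>\<infinity> * 0 = 0\<close> in \<open>ennreal\<close>, the
        infinite constant gives 0 for the empty set, where the left side must vanish too.\<close>
      proof (cases "S = {}")
        case False
        then have "lp_norm p (indicator S) \<noteq> 0"
          using q \<open>finite S\<close> by (simp add: lp_norm_indicator_finite card_gt_0_iff)
        then have "C * lp_norm p (indicator S) = \<infinity>" using True by (simp add: C_def ennreal_top_mult)
        then show ?thesis by simp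
      qed (simp add: lp_norm_def maximal_indicator_empty q)
    next
      case False
      then show ?thesis using \<open>1 \<le> q\<close> q \<open>finite S\<close> by (simp add: C_def lp_norm_maximal_le)
    qed
  qed
  moreover have single: "lp_norm p (indicator {0}) = 1"
    using q by (simp add: lp_norm_indicator_finite)
  have "C0_weak p = ennreal (2 powr (1 / q))"
  proof (rule C0_weak_eqI[OF _ single])
    fix S assume "lp_norm p (indicator S) < \<infinity>"
    then have "finite S" using q by (simp add: lp_norm_indicator_less_top_iff del: infinity_ennreal_def)
    then show "weak_norm p (maximal_fun (indicator S)) \<le> ennreal (2 powr (1 / q)) * lp_norm p (indicator S)"
      using \<open>1 \<le> q\<close> q by (simp add: weak_norm_maximal_le)
  qed (use \<open>1 \<le> q\<close> q weak_norm_maximal_singleton in simp)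
  moreover have "p = 1 \<longleftrightarrow> q = 1" using q by simp
  ultimately show ?thesis
    using False q lim single weak_norm_maximal_singleton[OF \<open>1 \<le> q\<close>] by (auto simp: C_def)
qed

end
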